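(* If $\mathbf{X}=(X_1,\dots,X_N)\in\mathbb{R}^N$ comprises independent random variables, which follow arbitrary probability measures $f_{\{i\}}(x_i)\,dx_i$, $i=1,\dots,N$, then the generalized ADD degenerates to the classical ADD; that is, for a square-integrable function $y$ of $\mathbf{X}$, $y_{u,G}=y_{u,C}$ for every $u\subseteq\{1,\dots,N\}$ (including $u=\emptyset$).
   Context: For $u\subseteq\{1,\dots,N\}$, $|u|$ is its cardinality, $-u:=\{1,\dots,N\}\setminus u$, $\mathbf{X}_u=(X_i)_{i\in u}$ and $\mathbf{x}_u=(x_i)_{i\in u}$. The random vector $\mathbf{X}$ has joint density $f_{\mathbf{X}}$ and, for $u\neq\emptyset$, the marginal density of $\mathbf{X}_u$ is $f_u(\mathbf{x}_u):=\int_{\mathbb{R}^{N-|u|}}f_{\mathbf{X}}(\mathbf{x})\,d\mathbf{x}_{-u}$; $f_{\{i\}}$ is the marginal density of $X_i$. The support of $f_{\mathbf{X}}$ is assumed grid-closed: for any point $\mathbf{x}\in\mathrm{supp}(f_{\mathbf{X}})$ one can traverse in each coordinate direction and find another point $\mathbf{x}'\in\mathrm{supp}(f_{\mathbf{X}})$. Component functions are identified when they agree almost everywhere with respect to $f_u(\mathbf{x}_u)\,d\mathbf{x}_u$. Generalized ADD (ANOVA dimensional decomposition): the decomposition $y(\mathbf{X})=\sum_{u\subseteq\{1,\dots,N\}}y_{u,G}(\mathbf{X}_u)$ of a square-integrable function $y$ (that is, $\mathbb{E}[y(\mathbf{X})^2]<\infty$), where $y_{\emptyset,G}$ is a constant,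 each $y_{u,G}$, $u\neq\emptyset$, is a function of $\mathbf{x}_u$ square-integrable with respect to $f_u(\mathbf{x}_u)\,d\mathbf{x}_u$, and the weak annihilating conditions hold: $\int_{\mathbb{R}}y_{u,G}(\mathbf{x}_u)f_u(\mathbf{x}_u)\,dx_i=0$ for every $i\in u\neq\emptyset$. Classical ADD (defined for independent coordinates, $f_{\mathbf{X}}(\mathbf{x})=\prod_{i=1}^N f_{\{i\}}(x_i)$): the decomposition $y(\mathbf{X})=\sum_{u\subseteq\{1,\dots,N\}}y_{u,C}(\mathbf{X}_u)$, where $y_{\emptyset,C}$ is a constant and the strong annihilating conditions hold: $\int_{\mathbb{R}}y_{u,C}(\mathbf{x}_u)f_{\{i\}}(x_i)\,dx_i=0$ for every $i\in u\neq\emptyset$. Equivalently, $y_{\emptyset,C}=\int_{\mathbb{R}^N}y(\mathbf{x})\prod_{i=1}^N f_{\{i\}}(x_i)\,dx_i$ and $y_{u,C}(\mathbf{X}_u)=\int_{\mathbb{R}^{N-|u|}}y(\mathbf{X}_u,\mathbf{x}_{-u})\prod_{i\notin u}f_{\{i\}}(x_i)\,dx_i-\sum_{v\subset u}y_{v,C}(\mathbf{X}_v)$ (proper inclusion), where $(\mathbf{X}_u,\mathbf{x}_{-u})$ has $i$th component $X_i$ if $i\in u$ and $x_i$ if $i\notin u$. *)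

theory Defs
  imports "HOL-Probability.Probability"
begin

text \<open>
  A point \<open>x\<^sub>u\<close> with \<open>u \<subseteq> {1..N}\<close> is an element of the space of \<open>Leb u\<close>, that is, a function on
  the indices that is \<open>undefined\<close> outside \<open>u\<close>. For \<open>u = {}\<close> this space has exactly one point, so a
  component function indexed by \<open>{}\<close> is a constant.
\<close>

abbreviation Leb :: "nat set \<Rightarrow> (nat \<Rightarrow> real) measure" where
  "Leb u \<equiv> Pi\<^sub>M u (\<lambda>_. lborel)"

definition subvector :: "(nat \<Rightarrow> 'a \<Rightarrow> real) \<Rightarrow> nat set \<Rightarrow> 'a \<Rightarrow> (nat \<Rightarrow> real)" where
  "subvector X u \<omega> = (\<lambda>i\<in>u. X i \<omega>)"

definition marginal :: "nat \<Rightarrow> ((nat \<Rightarrow> real) \<Rightarrow> real) \<Rightarrow> nat set \<Rightarrow> (nat \<Rightarrow> real) \<Rightarrow> real" where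
  "marginal N f u x = (LINT z|Leb ({1..N} - u). f (merge u ({1..N} - u) (x, z)))"

text \<open>
  The measure \<open>f\<^sub>u(x\<^sub>u) dx\<^sub>u\<close>. For \<open>u = {}\<close> it is the unit mass on the one-point space.
\<close>

definition marginal_measure ::
  "nat \<Rightarrow> ((nat \<Rightarrow> real) \<Rightarrow> real) \<Rightarrow> nat set \<Rightarrow> (nat \<Rightarrow> real) measure" where
  "marginal_measure N f u = density (Leb u) (\<lambda>x. ennreal (marginal N f u x))"

text \<open>
  A density is only determined up to Lebesgue-null sets, so its support is taken to be that of the
  measure it defines.
\<close>

definition density_support :: "nat \<Rightarrow> ((nat \<Rightarrow> real) \<Rightarrow> real) \<Rightarrow> (nat \<Rightarrow> real) set" where
  "density_support N f =
    {x \<in> space (Leb {1..N}).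
      \<forall>U. openin (product_topology (\<lambda>_. euclideanreal) {1..N}) U \<and> x \<in> U \<longrightarrow>
        emeasure (density (Leb {1..N}) (\<lambda>z. ennreal (f z))) U > 0}"

definition grid_closed :: "nat \<Rightarrow> (nat \<Rightarrow> real) set \<Rightarrow> bool" where
  "grid_closed N S \<longleftrightarrow> (\<forall>x\<in>S. \<forall>i\<in>{1..N}. \<exists>t. t \<noteq> x i \<and> x(i := t) \<in> S)"

definition is_decomposition ::
  "'a measure \<Rightarrow> (nat \<Rightarrow> 'a \<Rightarrow> real) \<Rightarrow> nat \<Rightarrow> ((nat \<Rightarrow> real) \<Rightarrow> real)
    \<Rightarrow> (nat set \<Rightarrow> (nat \<Rightarrow> real) \<Rightarrow> real) \<Rightarrow> bool" where
  "is_decomposition M X N y c \<longleftrightarrow>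
    (AE \<omega> in M. y (subvector X {1..N} \<omega>) = (\<Sum>u\<in>Pow {1..N}. c u (subvector X u \<omega>)))"

text \<open>
  In both annihilating conditions the integral over \<open>x\<^sub>i\<close> is required to exist and to vanish. As
  component functions are identified up to null sets of \<open>f\<^sub>u(x\<^sub>u) dx\<^sub>u\<close>, this can only be demanded for
  almost all values of the remaining coordinates.
\<close>

definition weak_annihilating ::
  "nat \<Rightarrow> ((nat \<Rightarrow> real) \<Rightarrow> real) \<Rightarrow> (nat set \<Rightarrow> (nat \<Rightarrow> real) \<Rightarrow> real) \<Rightarrow> bool" where
  "weak_annihilating N f c \<longleftrightarrow>
    (\<forall>u\<subseteq>{1..N}. \<forall>i\<in>u. AE x in marginal_measure N f (u - {i}).
      has_bochner_integral lborel
        (\<lambda>t. c u (x(i := t)) * marginal N f u (x(i := t))) 0)"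

definition strong_annihilating ::
  "nat \<Rightarrow> ((nat \<Rightarrow> real) \<Rightarrow> real) \<Rightarrow> (nat set \<Rightarrow> (nat \<Rightarrow> real) \<Rightarrow> real) \<Rightarrow> bool" where
  "strong_annihilating N f c \<longleftrightarrow>
    (\<forall>u\<subseteq>{1..N}. \<forall>i\<in>u. AE x in marginal_measure N f (u - {i}).
      has_bochner_integral lborel
        (\<lambda>t. c u (x(i := t)) * marginal N f {i} (\<lambda>j\<in>{i}. t)) 0)"

definition generalized_ADD ::
  "'a measure \<Rightarrow> (nat \<Rightarrow> 'a \<Rightarrow> real) \<Rightarrow> nat \<Rightarrow> ((nat \<Rightarrow> real) \<Rightarrow> real) \<Rightarrow> ((nat \<Rightarrow> real) \<Rightarrow> real)
    \<Rightarrow> (nat set \<Rightarrow> (nat \<Rightarrow> real) \<Rightarrow> real) \<Rightarrow> bool" where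
  "generalized_ADD M X N f y c \<longleftrightarrow>
    is_decomposition M X N y c \<and>
    (\<forall>u\<subseteq>{1..N}. u \<noteq> {} \<longrightarrow> c u \<in> borel_measurable (Leb u) \<and>
      integrable (marginal_measure N f u) (\<lambda>x. (c u x)\<^sup>2)) \<and>
    weak_annihilating N f c"

definition classical_ADD ::
  "'a measure \<Rightarrow> (nat \<Rightarrow> 'a \<Rightarrow> real) \<Rightarrow> nat \<Rightarrow> ((nat \<Rightarrow> real) \<Rightarrow> real) \<Rightarrow> ((nat \<Rightarrow> real) \<Rightarrow> real)
    \<Rightarrow> (nat set \<Rightarrow> (nat \<Rightarrow> real) \<Rightarrow> real) \<Rightarrow> bool" where
  "classical_ADD M X N f y c \<longleftrightarrow>
    is_decomposition M X N y c \<and>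
    (\<forall>u\<subseteq>{1..N}. u \<noteq> {} \<longrightarrow> c u \<in> borel_measurable (Leb u)) \<and>
    strong_annihilating N f c"

end

theory Submission
  imports Defs
begin

text \<open>
  Under independence \<open>f\<^sub>u\<close> is almost everywhere the product of the one-dimensional marginals, so
  dividing the weak condition by the positive factor \<open>f\<^bsub>u - {i}\<^esub>\<close> yields the strong one. For
  the difference \<open>d\<close> of two decompositions satisfying the strong condition, integrating the
  identity \<open>\<Sum>\<^sub>u d\<^sub>u = 0\<close> over the coordinates outside \<open>v\<close>, one at a time, kills every \<open>d\<^sub>u\<close> with
  \<open>u\<close> not contained in \<open>v\<close>. Hence the sum of \<open>d\<^sub>u\<close> over \<open>u \<subseteq> v\<close> vanishes for every \<open>v\<close>, and
  \<open>d\<^sub>v = 0\<close> follows by induction on \<open>v\<close>.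
\<close>

section \<open>Almost-everywhere statements on product measures\<close>

text \<open>Fubini for the indicator of a measurable null set covering the exceptions: its iterated
  integral is zero, so almost every section is null. Passing to the cover allows \<open>Q\<close> to
  be nonmeasurable.\<close>

lemma (in product_sigma_finite) AE_PiM_insertD:
  assumes "finite I" "i \<notin> I"
    and "AE x in PiM (insert i I) M. Q x"
  shows "AE x in PiM I M. AE t in M i. Q (x(i := t))"
proof -
  obtain S where S: "S \<in> null_sets (PiM (insert i I) M)"
    and sub: "{x \<in> space (PiM (insert i I) M). \<not> Q x} \<subseteq> S"
    using assms(3) by (auto simp: eventually_ae_filter)
  have [measurable]: "S \<in> sets (PiM (insert i I) M)"
    using S by auto
  have upd: "(\<lambda>(x, t). x(i := t)) \<in> measurable (PiM I M \<Otimes>\<^sub>M M i) (PiM (insert i I) M)"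
    by (rule measurable_add_dim)
  have ind: "(\<lambda>(x, t). indicator S (x(i := t)) :: ennreal)
      \<in> borel_measurable (PiM I M \<Otimes>\<^sub>M M i)"
    using measurable_compose[OF upd, of "indicator S :: _ \<Rightarrow> ennreal"]
    by (simp add: case_prod_beta')
  have "(\<integral>\<^sup>+ x. (\<integral>\<^sup>+ t. indicator S (x(i := t)) \<partial>M i) \<partial>PiM I M) = 0"
    using S product_nn_integral_insert[OF assms(1,2), of "indicator S"]
    by (simp add: null_setsD1)
  then have "AE x in PiM I M. (\<integral>\<^sup>+ t. indicator S (x(i := t)) \<partial>M i) = 0"
    by (subst (asm) nn_integral_0_iff_AE)
      (use sigma_finite_measure.borel_measurable_nn_integral[OF sigma_finite_measures ind] in auto)
  then show ?thesis
    using AE_space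
  proof eventually_elim
    case (elim x)
    have in_space: "x(i := t) \<in> space (PiM (insert i I) M)" if "t \<in> space (M i)" for t
      using measurable_space[OF upd, of "(x, t)"] elim(2) that by (simp add: space_pair_measure)
    have "(\<lambda>t. indicator S (x(i := t)) :: ennreal) \<in> borel_measurable (M i)"
      using measurable_compose[OF measurable_Pair1'[OF elim(2)] ind] by simp
    then have "AE t in M i. indicator S (x(i := t)) = (0::ennreal)"
      using elim(1) by (subst (asm) nn_integral_0_iff_AE) auto
    then show ?case
      using AE_space
    proof eventually_elim
      case (elim t)
      then show ?case using in_space[of t] sub by (auto simp: indicator_eq_0_iff)
    qed
  qed
qed

text \<open>Each discarded coordinate carries total mass one, so the image of \<open>PiM K M\<close>
  under restriction to \<open>J\<close> is exactly \<open>PiM J M\<close>.\<close>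

lemma (in product_prob_space) AE_PiM_restrict:
  assumes "finite K" "J \<subseteq> K" "AE x in PiM J M. Q x"
  shows "AE x in PiM K M. Q (restrict x J)"
proof (rule AE_distrD[where f="\<lambda>x. restrict x J" and M'="PiM J M" and P=Q])
  show "(\<lambda>x. restrict x J) \<in> measurable (PiM K M) (PiM J M)"
    using assms(2) by (rule measurable_restrict_subset)
  show "AE x in distr (PiM K M) (PiM J M) (\<lambda>x. restrict x J). Q x"
    using assms(3) by (simp only: distr_restrict[OF assms(2,1), symmetric])
qed

section \<open>Vanishing of annihilating components over a product of probability measures\<close>

text \<open>
  Only the integrals in one coordinate are used, so the components need not be jointly integrable.
\<close>

lemma (in product_prob_space) AE_sum_subsets_zero:
  fixes d :: "'i set \<Rightarrow> ('i \<Rightarrow> 'a) \<Rightarrow> real"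
  assumes "finite K"
    and annihilating: "\<And>u i. u \<subseteq> K \<Longrightarrow> i \<in> u \<Longrightarrow>
      AE x in PiM (u - {i}) M. has_bochner_integral (M i) (\<lambda>t. d u (x(i := t))) 0"
    and sum_zero: "AE x in PiM K M. (\<Sum>u\<in>Pow K. d u (restrict x u)) = 0"
    and "w \<subseteq> K"
  shows "AE x in PiM (K - w) M. (\<Sum>u\<in>Pow (K - w). d u (restrict x u)) = 0"
proof -
  have "finite w" using assms(1,4) finite_subset by blast
  then show ?thesis using \<open>w \<subseteq> K\<close>
  proof (induction w rule: finite_induct)
    case empty
    then show ?case using sum_zero by (simp only: Diff_empty)
  next
    case (insert i w)
    define v where "v = K - insert i w"
    have v: "finite v" "i \<notin> v" "K - w = insert i v" "v \<subseteq> K"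
      using insert \<open>finite K\<close> by (auto simp: v_def)
    \<comment> \<open>The condition for \<open>u\<close> lives on the coordinates
      \<open>u - {i}\<close>, all of which lie in \<open>v\<close>. Pulled back along restriction,
      the finitely many conditions hold off one common null set of \<open>PiM v M\<close>.\<close>
    have ann: "AE x in PiM v M. \<forall>u\<in>{u\<in>Pow (insert i v). i \<in> u}.
        has_bochner_integral (M i) (\<lambda>t. d u (restrict (x(i := t)) u)) 0"
    proof (intro AE_finite_allI)
      fix u assume u: "u \<in> {u\<in>Pow (insert i v). i \<in> u}"
      then have "u \<subseteq> K" "i \<in> u" using v by auto
      have upd: "(restrict x (u - {i}))(i := t) = restrict (x(i := t)) u" for x t
        using u by (auto simp: fun_eq_iff)
      have "u - {i} \<subseteq> v" using u by auto
      from AE_PiM_restrict[OF v(1) this annihilating[OF \<open>u \<subseteq> K\<close> \<open>i \<in> u\<close>]]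
      show "AE x in PiM v M. has_bochner_integral (M i)
          (\<lambda>t. d u (restrict (x(i := t)) u)) 0" unfolding upd .
    qed (simp add: v(1))
    have "AE x in PiM (insert i v) M. (\<Sum>u\<in>Pow (insert i v). d u (restrict x u)) = 0"
      using insert.IH insert.prems unfolding v(3) by blast
    from AE_PiM_insertD[OF v(1,2) this] ann
    have "AE x in PiM v M. (\<Sum>u\<in>Pow v. d u (restrict x u)) = 0"
    proof eventually_elim
      case (elim x)
      \<comment> \<open>With \<open>x\<close> fixed, a term involving the coordinate
        \<open>i\<close> integrates to zero; any other term is constant in \<open>t\<close> and
        equals its own mean because \<open>M i\<close> has mass one.\<close>
      have "has_bochner_integral (M i) (\<lambda>t. d u (restrict (x(i := t)) u))
          (if i \<in> u then 0 else d u (restrict x u))" if "u \<in> Pow (insert i v)" for u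
      proof (cases "i \<in> u")
        case True
        then show ?thesis using elim(2) that by simp
      next
        case False
        then have "restrict (x(i := t)) u = restrict x u" for t
          by (auto simp: fun_eq_iff)
        then show ?thesis
          using False by (simp add: has_bochner_integral_iff prob_space.prob_space[OF prob_space])
      qed
      then have "has_bochner_integral (M i)
          (\<lambda>t. \<Sum>u\<in>Pow (insert i v). d u (restrict (x(i := t)) u))
          (\<Sum>u\<in>Pow (insert i v). if i \<in> u then 0 else d u (restrict x u))"
        by (rule has_bochner_integral_sum)
      \<comment> \<open>The integrand is zero for almost every \<open>t\<close>, so the value just
        computed for its integral must be zero.\<close>
      from has_bochner_integral_eq_AE[OF this has_bochner_integral_zero elim(1)]
      have "(\<Sum>u\<in>Pow (insert i v). if i \<in> u then 0 else d u (restrict x u)) = 0" .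
      moreover have "(\<Sum>u\<in>Pow (insert i v). if i \<in> u then 0 else d u (restrict x u))
          = (\<Sum>u\<in>Pow v. d u (restrict x u))"
        using v(1,2) by (intro sum.mono_neutral_cong_right) auto
      ultimately show ?case by simp
    qed
    then show ?case unfolding v_def .
  qed
qed

lemma (in product_prob_space) annihilating_components_AE_zero:
  fixes d :: "'i set \<Rightarrow> ('i \<Rightarrow> 'a) \<Rightarrow> real"
  assumes "finite K"
    and "\<And>u i. u \<subseteq> K \<Longrightarrow> i \<in> u \<Longrightarrow>
      AE x in PiM (u - {i}) M. has_bochner_integral (M i) (\<lambda>t. d u (x(i := t))) 0"
    and "AE x in PiM K M. (\<Sum>u\<in>Pow K. d u (restrict x u)) = 0"
    and "v \<subseteq> K"
  shows "AE x in PiM v M. d v x = 0"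
proof -
  have "finite v" using assms(1,4) finite_subset by blast
  then show ?thesis using \<open>v \<subseteq> K\<close>
  proof (induction v rule: finite_psubset_induct)
    case (psubset v)
    \<comment> \<open>The induction hypothesis for \<open>u\<close> is a statement on
      \<open>PiM u M\<close>; restriction lifts it to \<open>PiM v M\<close>.\<close>
    have "AE x in PiM v M. \<forall>u\<in>{u. u \<subset> v}. d u (restrict x u) = 0"
    proof (intro AE_finite_allI)
      fix u assume "u \<in> {u. u \<subset> v}"
      then show "AE x in PiM v M. d u (restrict x u) = 0"
        using psubset by (intro AE_PiM_restrict) auto
    qed (rule finite_subset[of _ "Pow v"], use psubset in auto)
    \<comment> \<open>Eliminating the coordinates in \<open>K - v\<close> leaves the subsets of
      \<open>v\<close>, and of these only \<open>v\<close> itself can still contribute.\<close>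
    moreover have "AE x in PiM v M. (\<Sum>u\<in>Pow v. d u (restrict x u)) = 0"
      using AE_sum_subsets_zero[OF assms(1-3), of "K - v"]
      by (simp only: double_diff[OF psubset.prems order_refl] Diff_subset)
    ultimately show ?case
      using AE_space
    proof eventually_elim
      case (elim x)
      have "(\<Sum>u\<in>Pow v. d u (restrict x u)) = (\<Sum>u\<in>{v}. d u (restrict x u))"
        using elim(1) psubset by (intro sum.mono_neutral_right) auto
      moreover have "restrict x v = x"
        using elim(3) by (auto simp: space_PiM)
      ultimately show ?case using elim(2) by simp
    qed
  qed
qed

section \<open>Densities of products and laws of subvectors\<close>

text \<open>A finite product of sigma-finite measures is determined by its values on boxes. On a box
  the weighted indicator splits into functions of single coordinates, so its integral is a product
  of integrals.\<close>

lemma PiM_eq_density: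
  fixes M P :: "'i \<Rightarrow> 'a measure" and g :: "'i \<Rightarrow> 'a \<Rightarrow> ennreal"
  assumes "product_sigma_finite M" "product_sigma_finite P" "finite I"
    and [measurable]: "\<And>i. i \<in> I \<Longrightarrow> g i \<in> borel_measurable (M i)"
    and P: "\<And>i. i \<in> I \<Longrightarrow> P i = density (M i) (g i)"
  shows "PiM I P = density (PiM I M) (\<lambda>x. \<Prod>i\<in>I. g i (x i))"
proof -
  interpret M: product_sigma_finite M by fact
  interpret P: product_sigma_finite P by fact
  have [measurable]: "(\<lambda>x. \<Prod>i\<in>I. g i (x i)) \<in> borel_measurable (PiM I M)"
    by measurable
  show ?thesis
  proof (rule P.PiM_eqI[OF \<open>finite I\<close>, symmetric])
    show "sets (density (PiM I M) (\<lambda>x. \<Prod>i\<in>I. g i (x i))) = sets (PiM I P)"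
      unfolding sets_density by (rule sets_PiM_cong) (simp_all add: P)
  next
    fix A assume "\<And>i. i \<in> I \<Longrightarrow> A i \<in> sets (P i)"
    then have A[measurable]: "\<And>i. i \<in> I \<Longrightarrow> A i \<in> sets (M i)" by (simp add: P)
    have "emeasure (density (PiM I M) (\<lambda>x. \<Prod>i\<in>I. g i (x i))) (Pi\<^sub>E I A)
        = (\<integral>\<^sup>+ x. (\<Prod>i\<in>I. g i (x i)) * indicator (Pi\<^sub>E I A) x \<partial>PiM I M)"
      using \<open>finite I\<close> by (intro emeasure_density) (auto intro: sets_PiM_I_finite)
    also have "\<dots> = (\<integral>\<^sup>+ x. (\<Prod>i\<in>I. g i (x i) * indicator (A i) (x i)) \<partial>PiM I M)"
      using \<open>finite I\<close>
      by (intro nn_integral_cong)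
        (auto simp: prod.distrib indicator_def space_PiM PiE_def Pi_iff prod.If_cases)
    also have "\<dots> = (\<Prod>i\<in>I. \<integral>\<^sup>+ t. g i t * indicator (A i) t \<partial>M i)"
      using \<open>finite I\<close> by (intro M.product_nn_integral_prod) auto
    also have "\<dots> = (\<Prod>i\<in>I. emeasure (P i) (A i))"
      by (intro prod.cong refl) (simp add: P emeasure_density)
    finally show "emeasure (density (PiM I M) (\<lambda>x. \<Prod>i\<in>I. g i (x i))) (Pi\<^sub>E I A)
        = (\<Prod>i\<in>I. emeasure (P i) (A i))" .
  qed
qed

interpretation lborel_product: product_sigma_finite "\<lambda>_::nat. lborel :: real measure"
  by standard

text \<open>\<open>distributed\<close> makes only the \<open>ennreal\<close> image of
  \<open>f\<close> measurable; nonnegativity lets \<open>enn2real\<close> recover \<open>f\<close>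
  from it on the space.\<close>

lemma borel_measurable_density_function:
  assumes "\<And>x. x \<in> space L \<Longrightarrow> 0 \<le> f x" "distributed M L Z (\<lambda>x. ennreal (f x))"
  shows "(f :: _ \<Rightarrow> real) \<in> borel_measurable L"
proof -
  have "(\<lambda>x. enn2real (ennreal (f x))) \<in> borel_measurable L"
    using distributed_borel_measurable[OF assms(2)] by measurable
  then show ?thesis
    by (rule measurable_cong[THEN iffD1, rotated]) (use assms(1) in auto)
qed

lemma measurable_merge_complement:
  assumes "u \<subseteq> {1..N}"
  shows "merge u ({1..N} - u) \<in> measurable (Leb u \<Otimes>\<^sub>M Leb ({1..N} - u)) (Leb {1..N})"
proof -
  have "u \<union> ({1..N} - u) = {1..N}" using assms by auto
  with measurable_merge[of u "{1..N} - u" "\<lambda>_. lborel"] show ?thesis by (simp only:)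
qed

lemma measurable_marginal:
  assumes [measurable]: "f \<in> borel_measurable (Leb {1..N})" and "u \<subseteq> {1..N}"
  shows "marginal N f u \<in> borel_measurable (Leb u)"
proof -
  interpret sigma_finite_measure "Leb ({1..N} - u)"
    by (rule lborel_product.sigma_finite) simp
  have "(\<lambda>p. f (merge u ({1..N} - u) p)) \<in> borel_measurable (Leb u \<Otimes>\<^sub>M Leb ({1..N} - u))"
    using measurable_merge_complement[OF assms(2)] assms(1) by (rule measurable_compose)
  then show ?thesis
    unfolding marginal_def by (intro borel_measurable_lebesgue_integral) (simp add: case_prod_beta')
qed

text \<open>Tonelli, with one point of care: \<open>marginal\<close> is a Bochner integral, which is
  0 by default on fibers where \<open>f\<close> is not integrable.\<close>

lemma marginal_measure_eq_distr:
  assumes "prob_space M"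
    and nonneg: "\<And>x. x \<in> space (Leb {1..N}) \<Longrightarrow> 0 \<le> f x"
    and dens: "distributed M (Leb {1..N}) (subvector X {1..N}) (\<lambda>x. ennreal (f x))"
    and u: "u \<subseteq> {1..N}"
  shows "marginal_measure N f u = distr M (Leb u) (subvector X u)"
proof -
  interpret prob_space M by fact
  define w where "w = {1..N} - u"
  have w: "u \<union> w = {1..N}" "u \<inter> w = {}" "finite u" "finite w"
    using u by (auto simp: w_def intro: finite_subset)
  have f[measurable]: "f \<in> borel_measurable (Leb {1..N})"
    by (rule borel_measurable_density_function[OF nonneg dens])
  have marg[measurable]: "marginal N f u \<in> borel_measurable (Leb u)"
    by (rule measurable_marginal[OF f u])
  have merge: "merge u w \<in> measurable (Leb u \<Otimes>\<^sub>M Leb w) (Leb {1..N})"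
    unfolding w_def by (rule measurable_merge_complement[OF u])
  have f_merge: "(\<lambda>p. f (merge u w p)) \<in> borel_measurable (Leb u \<Otimes>\<^sub>M Leb w)"
    using merge by measurable
  have fold: "integral\<^sup>N (Leb {1..N}) h = (\<integral>\<^sup>+ x. \<integral>\<^sup>+ z. h (merge u w (x, z)) \<partial>Leb w \<partial>Leb u)"
    if "h \<in> borel_measurable (Leb {1..N})" for h
    using lborel_product.product_nn_integral_fold[of u w h] w that by simp
  interpret W: sigma_finite_measure "Leb w"
    by (rule lborel_product.sigma_finite) (rule w)
  have [measurable]: "(\<lambda>x. \<integral>\<^sup>+ z. ennreal (f (merge u w (x, z))) \<partial>Leb w) \<in> borel_measurable (Leb u)"
    using f_merge by (intro W.borel_measurable_nn_integral) (simp add: case_prod_beta')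
  have "(\<integral>\<^sup>+ x. ennreal (f x) \<partial>Leb {1..N}) = 1"
    using distributed_nn_integral[OF dens, of "\<lambda>_. 1"] emeasure_space_1 by simp
  \<comment> \<open>Total mass one forces almost every fiber integral to be finite, so the default
    value occurs on a null set only.\<close>
  then have "AE x in Leb u. (\<integral>\<^sup>+ z. ennreal (f (merge u w (x, z))) \<partial>Leb w) \<noteq> \<infinity>"
    using fold[of "\<lambda>x. ennreal (f x)"] distributed_borel_measurable[OF dens]
    by (intro nn_integral_PInf_AE) auto
  then have marginal_eq: "AE x in Leb u.
      ennreal (marginal N f u x) = (\<integral>\<^sup>+ z. ennreal (f (merge u w (x, z))) \<partial>Leb w)"
    using AE_space
  proof eventually_elim
    case (elim x)
    have "(\<lambda>z. f (merge u w (x, z))) \<in> borel_measurable (Leb w)"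
      using measurable_compose[OF measurable_Pair1'[OF elim(2)] f_merge] by simp
    moreover have "0 \<le> f (merge u w (x, z))" if "z \<in> space (Leb w)" for z
      using measurable_space[OF merge, of "(x, z)"] elim(2) that
      by (intro nonneg) (simp add: space_pair_measure)
    ultimately show ?case
      using elim(1) unfolding marginal_def w_def[symmetric]
      by (subst integral_eq_nn_integral) (auto simp: less_top[symmetric])
  qed
  have X: "subvector X {1..N} \<in> measurable M (Leb {1..N})"
    by (rule distributed_measurable[OF dens])
  have restr: "(\<lambda>x. restrict x u) \<in> measurable (Leb {1..N}) (Leb u)"
    using u by (rule measurable_restrict_subset)
  have Xu_eq: "restrict (subvector X {1..N} \<omega>) u = subvector X u \<omega>" for \<omega>
    using u by (auto simp: subvector_def fun_eq_iff)
  have Xu[measurable]: "subvector X u \<in> measurable M (Leb u)"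
    using measurable_compose[OF X restr] unfolding Xu_eq .
  show ?thesis
  proof (rule measure_eqI)
    fix A assume "A \<in> sets (marginal_measure N f u)"
    then have A[measurable]: "A \<in> sets (Leb u)"
      by (simp add: marginal_measure_def)
    have ind[measurable]: "(\<lambda>x. indicator A (restrict x u) :: ennreal) \<in> borel_measurable (Leb {1..N})"
      using restr by (rule measurable_compose) measurable
    have "emeasure (marginal_measure N f u) A
        = (\<integral>\<^sup>+ x. ennreal (marginal N f u x) * indicator A x \<partial>Leb u)"
      unfolding marginal_measure_def by (rule emeasure_density) measurable
    \<comment> \<open>Restricting the merged point to \<open>u\<close> returns \<open>x\<close>, so
      the indicator can move inside the fiber integral and the integrand becomes a function of the
      full point.\<close>
    also have "\<dots> = (\<integral>\<^sup>+ x. \<integral>\<^sup>+ z. ennreal (f (merge u w (x, z)))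
        * indicator A (restrict (merge u w (x, z)) u) \<partial>Leb w \<partial>Leb u)"
    proof (rule nn_integral_cong_AE)
      show "AE x in Leb u. ennreal (marginal N f u x) * indicator A x
        = (\<integral>\<^sup>+ z. ennreal (f (merge u w (x, z))) * indicator A (restrict (merge u w (x, z)) u) \<partial>Leb w)"
        using marginal_eq AE_space
      proof eventually_elim
        case (elim x)
        have "(\<lambda>z. ennreal (f (merge u w (x, z)))) \<in> borel_measurable (Leb w)"
          using measurable_compose[OF measurable_Pair1'[OF elim(2)] f_merge] by simp
        moreover have "restrict (merge u w (x, z)) u = x" for z
          using elim(2) w by (auto simp: space_PiM restrict_merge PiE_restrict)
        ultimately show ?case
          using elim(1) by (simp add: nn_integral_multc)
      qed
    qed
    also have "\<dots> = (\<integral>\<^sup>+ x. ennreal (f x) * indicator A (restrict x u) \<partial>Leb {1..N})"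
      by (rule fold[symmetric]) measurable
    also have "\<dots> = (\<integral>\<^sup>+ \<omega>. indicator A (restrict (subvector X {1..N} \<omega>) u) \<partial>M)"
      by (rule distributed_nn_integral[OF dens ind])
    also have "\<dots> = (\<integral>\<^sup>+ x. indicator A x \<partial>distr M (Leb u) (subvector X u))"
      unfolding Xu_eq by (subst nn_integral_distr) auto
    also have "\<dots> = emeasure (distr M (Leb u) (subvector X u)) A"
      by simp
    finally show "emeasure (marginal_measure N f u) A = emeasure (distr M (Leb u) (subvector X u)) A" .
  qed (simp add: marginal_measure_def)
qed

lemma marginal_nonneg:
  assumes nonneg: "\<And>x. x \<in> space (Leb {1..N}) \<Longrightarrow> 0 \<le> f x"
    and "u \<subseteq> {1..N}" "x \<in> space (Leb u)"
  shows "0 \<le> marginal N f u x"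
proof -
  show ?thesis
    unfolding marginal_def
    using assms(3) measurable_space[OF measurable_merge_complement[OF assms(2)], of "(x, z)" for z]
    by (intro Bochner_Integration.integral_nonneg nonneg) (simp add: space_pair_measure)
qed

section \<open>Product structure of the laws under independence\<close>

locale independent_density = prob_space M for M :: "'a measure" +
  fixes X :: "nat \<Rightarrow> 'a \<Rightarrow> real" and N :: nat and f :: "(nat \<Rightarrow> real) \<Rightarrow> real"
  assumes N: "N \<ge> 1"
    and nonneg: "\<And>x. x \<in> space (Leb {1..N}) \<Longrightarrow> 0 \<le> f x"
    and dens: "distributed M (Leb {1..N}) (subvector X {1..N}) (\<lambda>x. ennreal (f x))"
    and indep: "indep_vars (\<lambda>_. borel) X {1..N}"
begin

text \<open>
  The case distinction makes every factor a probability measure, as \<open>product_prob_space\<close> demands.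
\<close>

definition law :: "nat \<Rightarrow> real measure" where
  "law i = distr M borel (if i \<in> {1..N} then X i else (\<lambda>_. 0))"

text \<open>\<open>marginal\<close> takes points of \<open>Leb {i}\<close>; this version takes the
  real coordinate itself and so can serve as a density with respect to
  \<open>lborel\<close>.\<close>

definition marginal1 :: "nat \<Rightarrow> real \<Rightarrow> real" where
  "marginal1 i t = marginal N f {i} (\<lambda>j\<in>{i}. t)"

lemma random_variable_X: "i \<in> {1..N} \<Longrightarrow> X i \<in> borel_measurable M"
  using indep by (auto simp: indep_vars_def)

lemma sets_law [simp, measurable_cong]: "sets (law i) = sets borel"
  by (simp add: law_def)

lemma space_law [simp]: "space (law i) = UNIV"
  by (simp add: law_def)

lemma sets_PiM_law [measurable_cong]: "sets (PiM u law) = sets (Leb u)"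
  by (rule sets_PiM_cong) simp_all

sublocale laws: product_prob_space law
proof -
  have "prob_space (law i)" for i
    unfolding law_def using random_variable_X by (intro prob_space_distr) auto
  then show "product_prob_space law"
    by (intro product_prob_space.intro product_prob_space_axioms.intro product_sigma_finite.intro)
      (auto intro: prob_space_imp_sigma_finite)
qed

text \<open>Independence is equivalent to the joint law being the product of the coordinate laws.
  The equivalence asks for a nonempty index set, which \<open>N \<ge> 1\<close> provides.\<close>

lemma distr_subvector: "distr M (Leb {1..N}) (subvector X {1..N}) = PiM {1..N} law"
proof -
  have "distr M (Leb {1..N}) (subvector X {1..N})
      = distr M (\<Pi>\<^sub>M i\<in>{1..N}. borel) (\<lambda>\<omega>. \<lambda>i\<in>{1..N}. X i \<omega>)"
    by (intro distr_cong sets_PiM_cong) (simp_all add: subvector_def)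
  also have "\<dots> = (\<Pi>\<^sub>M i\<in>{1..N}. distr M borel (X i))"
    using indep_vars_iff_distr_eq_PiM'[where I="{1..N}" and M'="\<lambda>_. borel" and X=X]
      indep random_variable_X N
    by simp
  also have "\<dots> = PiM {1..N} law"
    by (rule PiM_cong) (simp_all add: law_def)
  finally show ?thesis .
qed

text \<open>The law of the subvector is the image of the joint law under restriction, and
  restricting a product of probability measures keeps the product of the remaining factors.\<close>

lemma marginal_measure_eq:
  assumes "u \<subseteq> {1..N}"
  shows "marginal_measure N f u = PiM u law"
proof -
  have X: "subvector X {1..N} \<in> measurable M (Leb {1..N})"
    by (rule distributed_measurable[OF dens])
  have restr: "(\<lambda>x. restrict x u) \<in> measurable (Leb {1..N}) (Leb u)"
    using assms by (rule measurable_restrict_subset)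
  have Xu_eq: "(\<lambda>x. restrict x u) \<circ> subvector X {1..N} = subvector X u"
    using assms by (auto simp: subvector_def fun_eq_iff)
  have "marginal_measure N f u = distr M (Leb u) (subvector X u)"
    by (rule marginal_measure_eq_distr[OF prob_space_axioms nonneg dens assms])
  also have "\<dots> = distr (PiM {1..N} law) (Leb u) (\<lambda>x. restrict x u)"
    unfolding distr_subvector[symmetric] by (simp only: distr_distr[OF restr X] Xu_eq)
  also have "\<dots> = distr (PiM {1..N} law) (PiM u law) (\<lambda>x. restrict x u)"
    by (intro distr_cong) (simp_all add: sets_PiM_law)
  also have "\<dots> = PiM u law"
    by (rule laws.distr_restrict[symmetric, OF assms]) simp
  finally show ?thesis .
qed

lemma measurable_f: "f \<in> borel_measurable (Leb {1..N})"
  by (rule borel_measurable_density_function[OF nonneg dens])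

lemma marginal1_nonneg: "i \<in> {1..N} \<Longrightarrow> 0 \<le> marginal1 i t"
  unfolding marginal1_def by (rule marginal_nonneg[OF nonneg]) (auto simp: space_PiM)

lemma measurable_marginal1 [measurable]:
  assumes "i \<in> {1..N}"
  shows "marginal1 i \<in> borel_measurable borel"
proof -
  have "marginal N f {i} \<in> borel_measurable (Leb {i})"
    using assms by (intro measurable_marginal[OF measurable_f]) auto
  moreover have "(\<lambda>t. \<lambda>j\<in>{i}. t) \<in> measurable lborel (Leb {i})"
    by (intro measurable_restrict) simp
  ultimately show ?thesis
    unfolding marginal1_def[abs_def] by (simp add: measurable_compose)
qed

text \<open>This is the case \<open>u = {i}\<close> of \<open>marginal_measure_eq\<close>,
  transported to the reals by evaluation at \<open>i\<close>, which carries \<open>Leb {i}\<close>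
  to \<open>lborel\<close>.\<close>

lemma law_eq_density:
  assumes "i \<in> {1..N}"
  shows "law i = density lborel (\<lambda>t. ennreal (marginal1 i t))"
proof -
  have "density lborel (\<lambda>t. ennreal (marginal1 i t))
      = density (distr (Leb {i}) lborel (\<lambda>x. x i)) (\<lambda>t. ennreal (marginal1 i t))"
    by (simp add: lborel_product.distr_singleton)
  also have "\<dots> = distr (density (Leb {i}) (\<lambda>x. ennreal (marginal1 i (x i)))) lborel (\<lambda>x. x i)"
    using measurable_marginal1[OF assms] by (intro density_distr) auto
  also have "density (Leb {i}) (\<lambda>x. ennreal (marginal1 i (x i))) = marginal_measure N f {i}"
    unfolding marginal_measure_def marginal1_def
  proof (rule density_cong)
    have m: "marginal N f {i} \<in> borel_measurable (Leb {i})"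
      using assms by (intro measurable_marginal[OF measurable_f]) auto
    then show "(\<lambda>x. ennreal (marginal N f {i} x)) \<in> borel_measurable (Leb {i})"
      by measurable
    have "(\<lambda>x. marginal1 i (x i)) \<in> borel_measurable (Leb {i})"
      using measurable_marginal1[OF assms] by measurable
    then show "(\<lambda>x. ennreal (marginal N f {i} (\<lambda>j\<in>{i}. x i))) \<in> borel_measurable (Leb {i})"
      unfolding marginal1_def by measurable
    \<comment> \<open>A point of \<open>Leb {i}\<close> is \<open>undefined\<close> off
      \<open>i\<close>, hence determined by its value at \<open>i\<close>.\<close>
    have "(\<lambda>j\<in>{i}. x i) = x" if "x \<in> space (Leb {i})" for x :: "nat \<Rightarrow> real"
      using that by (auto simp: space_PiM fun_eq_iff PiE_def extensional_def)
    then show "AE x in Leb {i}. ennreal (marginal N f {i} (\<lambda>j\<in>{i}. x i)) = ennreal (marginal N f {i} x)"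
      by (intro AE_I2) simp
  qed
  also have "\<dots> = PiM {i} law"
    using assms by (intro marginal_measure_eq) auto
  also have "distr (PiM {i} law) lborel (\<lambda>x. x i) = distr (PiM {i} law) (law i) (\<lambda>x. x i)"
    by (rule distr_cong) simp_all
  also have "\<dots> = law i"
    by (rule laws.distr_singleton)
  finally show ?thesis by (rule sym)
qed

text \<open>Both sides are densities of the same measure \<open>PiM u law\<close> with respect to
  the sigma-finite \<open>Leb u\<close>, and such densities are unique almost everywhere.\<close>

lemma AE_marginal_eq_prod:
  assumes u: "u \<subseteq> {1..N}"
  shows "AE x in Leb u. marginal N f u x = (\<Prod>i\<in>u. marginal1 i (x i))"
proof -
  have fin: "finite u" using u finite_subset by blast
  have g: "(\<lambda>t. ennreal (marginal1 i t)) \<in> borel_measurable lborel" if "i \<in> u" for i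
    using measurable_marginal1[of i] u that by auto
  interpret L: sigma_finite_measure "Leb u"
    by (rule lborel_product.sigma_finite) (rule fin)
  have "density (Leb u) (\<lambda>x. ennreal (marginal N f u x))
      = density (Leb u) (\<lambda>x. \<Prod>i\<in>u. ennreal (marginal1 i (x i)))"
    unfolding marginal_measure_def[symmetric] marginal_measure_eq[OF u]
    using u g fin
    by (intro PiM_eq_density lborel_product.product_sigma_finite_axioms
        laws.product_sigma_finite_axioms law_eq_density) auto
  then have "AE x in Leb u. ennreal (marginal N f u x) = (\<Prod>i\<in>u. ennreal (marginal1 i (x i)))"
  proof (rule L.density_unique[rotated 2])
    show "(\<lambda>x. ennreal (marginal N f u x)) \<in> borel_measurable (Leb u)"
      using measurable_marginal[OF measurable_f u] by measurable
    show "(\<lambda>x. \<Prod>i\<in>u. ennreal (marginal1 i (x i))) \<in> borel_measurable (Leb u)"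
      using g by (intro borel_measurable_prod_ennreal measurable_PiM_component_rev) auto
  qed
  then show ?thesis
    using AE_space
  proof eventually_elim
    case (elim x)
    \<comment> \<open>Uniqueness compares values in \<open>ennreal\<close>; as all the reals
      involved are nonnegative, the equation descends to them.\<close>
    have pos: "0 \<le> marginal1 i (x i)" if "i \<in> u" for i
      using marginal1_nonneg u that by auto
    have "ennreal (marginal N f u x) = ennreal (\<Prod>i\<in>u. marginal1 i (x i))"
      using elim(1) pos by (simp add: prod_ennreal)
    then show ?case
      using marginal_nonneg[OF nonneg u elim(2)] pos by (simp add: prod_nonneg)
  qed
qed

lemma measurable_update:
  assumes "c \<in> borel_measurable (Leb u)" "i \<in> u" "x \<in> space (Leb (u - {i}))"
  shows "(\<lambda>t. c (x(i := t)) :: real) \<in> borel_measurable lborel"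
proof -
  have "(\<lambda>(x, t). x(i := t)) \<in> measurable (Leb (u - {i}) \<Otimes>\<^sub>M lborel) (Leb u)"
    using measurable_add_dim[of i "u - {i}" "\<lambda>_. lborel"] assms(2) by (simp add: insert_absorb)
  from measurable_compose[OF measurable_Pair1'[OF assms(3)] measurable_compose[OF this assms(1)]]
  show ?thesis by simp
qed

section \<open>From the weak to the strong condition, and uniqueness\<close>

text \<open>Along the coordinate \<open>i\<close>, the density of \<open>u\<close> is that of
  \<open>i\<close> times that of \<open>u - {i}\<close>, a factor constant in \<open>t\<close>. Both
  conditions are demanded almost everywhere for the measure of \<open>u - {i}\<close>, hence only
  where this factor is positive.\<close>

lemma weak_imp_strong_annihilating:
  assumes meas: "\<And>u. u \<subseteq> {1..N} \<Longrightarrow> u \<noteq> {} \<Longrightarrow> c u \<in> borel_measurable (Leb u)"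
    and weak: "weak_annihilating N f c"
  shows "strong_annihilating N f c"
  unfolding strong_annihilating_def marginal1_def[symmetric]
proof (intro allI impI ballI)
  fix u i assume u: "u \<subseteq> {1..N}" and i: "i \<in> u"
  define v where "v = u - {i}"
  have v: "finite v" "i \<notin> v" "insert i v = u" "v \<subseteq> {1..N}"
    using u i by (auto simp: v_def intro: finite_subset)
  have iN: "i \<in> {1..N}" using u i by auto
  have mv: "(\<lambda>x. ennreal (marginal N f v x)) \<in> borel_measurable (Leb v)"
    using measurable_marginal[OF measurable_f v(4)] by measurable
  have "AE x in marginal_measure N f v.
      has_bochner_integral lborel (\<lambda>t. c u (x(i := t)) * marginal N f u (x(i := t))) 0"
    using weak u i unfolding weak_annihilating_def v_def by blast
  then have "AE x in Leb v. 0 < ennreal (marginal N f v x) \<longrightarrow>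
      has_bochner_integral lborel (\<lambda>t. c u (x(i := t)) * marginal N f u (x(i := t))) 0"
    unfolding marginal_measure_def AE_density[OF mv] .
  \<comment> \<open>The factorization on \<open>Leb u\<close> is sliced: for almost every
    \<open>x\<close> it holds at almost every \<open>t\<close>.\<close>
  moreover have "AE x in Leb v. AE t in lborel.
      marginal N f u (x(i := t)) = (\<Prod>j\<in>u. marginal1 j ((x(i := t)) j))"
    using AE_marginal_eq_prod[OF u] unfolding v(3)[symmetric]
    by (rule lborel_product.AE_PiM_insertD[OF v(1,2)])
  ultimately have "AE x in Leb v. 0 < ennreal (marginal N f v x) \<longrightarrow>
      has_bochner_integral lborel (\<lambda>t. c u (x(i := t)) * marginal1 i t) 0"
    using AE_marginal_eq_prod[OF v(4)] AE_space
  proof eventually_elim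
    case (elim x)
    show ?case
    proof
      assume pos: "0 < ennreal (marginal N f v x)"
      \<comment> \<open>The density of the coordinates in \<open>v\<close> at \<open>x\<close>, in
        factored form: free of \<open>t\<close>, and positive by the guard of the
        implication.\<close>
      define p where "p = (\<Prod>j\<in>v. marginal1 j (x j))"
      have p: "p > 0" using pos elim(3) by (simp add: p_def)
      have prod: "(\<Prod>j\<in>u. marginal1 j ((x(i := t)) j)) = marginal1 i t * p" for t
        using v(1,2) unfolding v(3)[symmetric] p_def
        by (simp add: prod.insert) (intro disjI2 prod.cong, auto)
      have cm: "(\<lambda>t. c u (x(i := t))) \<in> borel_measurable lborel"
        using u i elim(4) by (intro measurable_update[OF meas]) (auto simp: v_def)
      have mm: "(\<lambda>t. marginal N f u (x(i := t))) \<in> borel_measurable lborel"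
        using i elim(4)
        by (intro measurable_update[OF measurable_marginal[OF measurable_f u]]) (auto simp: v_def)
      have m1: "marginal1 i \<in> borel_measurable lborel"
        using measurable_marginal1[OF iN] by simp
      have "has_bochner_integral lborel (\<lambda>t. c u (x(i := t)) * marginal N f u (x(i := t))) 0"
        using elim(1) pos by blast
      moreover have "AE t in lborel. c u (x(i := t)) * marginal N f u (x(i := t))
          = c u (x(i := t)) * (marginal1 i t * p)"
        using elim(2) by eventually_elim (simp only: prod)
      \<comment> \<open>The integrands agree only for almost every \<open>t\<close>, so exchanging
        them uses the measurability of both.\<close>
      ultimately have "has_bochner_integral lborel (\<lambda>t. c u (x(i := t)) * (marginal1 i t * p)) 0"
        using has_bochner_integral_cong_AE[OF borel_measurable_times[OF cm mm]
            borel_measurable_times[OF cm borel_measurable_times[OF m1 borel_measurable_const]]]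
        by blast
      from has_bochner_integral_mult_left[OF this, of "inverse p"]
      show "has_bochner_integral lborel (\<lambda>t. c u (x(i := t)) * marginal1 i t) 0"
        using p by (simp add: mult.assoc)
    qed
  qed
  then show "AE x in marginal_measure N f (u - {i}).
      has_bochner_integral lborel (\<lambda>t. c u (x(i := t)) * marginal1 i t) 0"
    unfolding marginal_measure_def v_def[symmetric] by (subst AE_density[OF mv])
qed

text \<open>The weight \<open>marginal1 i\<close> is absorbed into the measure, so the condition
  becomes zero mean under \<open>law i\<close>, the form required by
  \<open>annihilating_components_AE_zero\<close>.\<close>

lemma strong_annihilating_law:
  assumes "\<And>u. u \<subseteq> {1..N} \<Longrightarrow> u \<noteq> {} \<Longrightarrow> c u \<in> borel_measurable (Leb u)"
    and "strong_annihilating N f c" "u \<subseteq> {1..N}" "i \<in> u"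
  shows "AE x in PiM (u - {i}) law. has_bochner_integral (law i) (\<lambda>t. c u (x(i := t))) 0"
proof -
  have i: "i \<in> {1..N}" and sub: "u - {i} \<subseteq> {1..N}" using assms(3,4) by auto
  have "AE x in PiM (u - {i}) law.
      has_bochner_integral lborel (\<lambda>t. c u (x(i := t)) * marginal1 i t) 0"
    using assms(2-4) unfolding strong_annihilating_def marginal1_def marginal_measure_eq[OF sub, symmetric]
    by blast
  then show ?thesis
    using AE_space
  proof eventually_elim
    case (elim x)
    have "x \<in> space (Leb (u - {i}))"
      using elim(2) sets_eq_imp_space_eq[OF sets_PiM_law] by blast
    then have "(\<lambda>t. c u (x(i := t))) \<in> borel_measurable lborel"
      using assms(3,4) by (intro measurable_update[OF assms(1)]) auto
    then show ?case
      unfolding law_eq_density[OF i]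
      using elim(1) measurable_marginal1[OF i] marginal1_nonneg[OF i]
      by (intro has_bochner_integral_density) (auto simp: mult.commute)
  qed
qed

text \<open>The strong condition is linear, so the differences of the components are annihilating as
  well, and they sum to zero.\<close>

lemma strong_decomposition_unique:
  assumes c: "\<And>u. u \<subseteq> {1..N} \<Longrightarrow> u \<noteq> {} \<Longrightarrow> c u \<in> borel_measurable (Leb u)"
      "strong_annihilating N f c" "is_decomposition M X N y c"
    and d: "\<And>u. u \<subseteq> {1..N} \<Longrightarrow> u \<noteq> {} \<Longrightarrow> d u \<in> borel_measurable (Leb u)"
      "strong_annihilating N f d" "is_decomposition M X N y d"
    and u: "u \<subseteq> {1..N}"
  shows "AE x in marginal_measure N f u. c u x = d u x"
proof -
  have meas: "(\<lambda>x. c u (restrict x u) - d u (restrict x u)) \<in> borel_measurable (Leb {1..N})"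
    if "u \<in> Pow {1..N}" for u
  \<comment> \<open>Measurability is assumed for nonempty \<open>u\<close> only; for
    \<open>u = {}\<close> the point \<open>restrict x {}\<close> does not depend on
    \<open>x\<close>, so the term is constant.\<close>
  proof (cases "u = {}")
    case False
    have restr: "(\<lambda>x. restrict x u) \<in> measurable (Leb {1..N}) (Leb u)"
      using that by (intro measurable_restrict_subset) auto
    show ?thesis
      using that False
      by (intro borel_measurable_diff measurable_compose[OF restr] c(1) d(1)) auto
  qed (simp add: restrict_def)
  have X: "subvector X {1..N} \<in> measurable M (Leb {1..N})"
    by (rule distributed_measurable[OF dens])
  have restr: "restrict (subvector X {1..N} \<omega>) u = subvector X u \<omega>" if "u \<in> Pow {1..N}" for u \<omega>
    using that by (auto simp: subvector_def fun_eq_iff)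
  have "AE \<omega> in M. (\<Sum>u\<in>Pow {1..N}.
      c u (restrict (subvector X {1..N} \<omega>) u) - d u (restrict (subvector X {1..N} \<omega>) u)) = 0"
    using c(3) d(3) unfolding is_decomposition_def
  proof eventually_elim
    case (elim \<omega>)
    have "(\<Sum>u\<in>Pow {1..N}. e u (restrict (subvector X {1..N} \<omega>) u))
        = (\<Sum>u\<in>Pow {1..N}. e u (subvector X u \<omega>))" for e :: "nat set \<Rightarrow> (nat \<Rightarrow> real) \<Rightarrow> real"
      by (intro sum.cong refl) (simp only: restr)
    then show ?case using elim by (simp only: sum_subtractf diff_self)
  qed
  \<comment> \<open>The identity moves from the sample space to the law of the random vector; the
    transfer needs its truth set to be measurable, hence \<open>meas\<close>.\<close>
  then have "AE x in PiM {1..N} law.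
      (\<Sum>u\<in>Pow {1..N}. c u (restrict x u) - d u (restrict x u)) = 0"
    unfolding distr_subvector[symmetric]
    by (subst AE_distr_iff[OF X borel_measurable_eq[OF borel_measurable_sum[OF meas] borel_measurable_const]])
  moreover have "AE x in PiM (u - {i}) law.
      has_bochner_integral (law i) (\<lambda>t. c u (x(i := t)) - d u (x(i := t))) 0"
    if "u \<subseteq> {1..N}" "i \<in> u" for u i
  proof -
    have "AE x in PiM (u - {i}) law. has_bochner_integral (law i) (\<lambda>t. c u (x(i := t))) 0"
      by (rule strong_annihilating_law[OF _ c(2) that]) (rule c(1))
    moreover have "AE x in PiM (u - {i}) law. has_bochner_integral (law i) (\<lambda>t. d u (x(i := t))) 0"
      by (rule strong_annihilating_law[OF _ d(2) that]) (rule d(1))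
    ultimately show ?thesis
      by eventually_elim (use has_bochner_integral_diff in fastforce)
  qed
  ultimately have "AE x in PiM u law. c u x - d u x = 0"
    using laws.annihilating_components_AE_zero[where K="{1..N}" and d="\<lambda>u x. c u x - d u x"] u
    by blast
  then show ?thesis
    unfolding marginal_measure_eq[OF u] by simp
qed

end

theorem corollary4p6:
  fixes M :: "'a measure"
    and X :: "nat \<Rightarrow> 'a \<Rightarrow> real"
    and N :: nat
    and f y :: "(nat \<Rightarrow> real) \<Rightarrow> real"
    and yG yC :: "nat set \<Rightarrow> (nat \<Rightarrow> real) \<Rightarrow> real"
  assumes "N \<ge> 1"
    and "prob_space M"
    and "\<And>x. x \<in> space (Leb {1..N}) \<Longrightarrow> 0 \<le> f x"
    and "distributed M (Leb {1..N}) (subvector X {1..N}) (\<lambda>x. ennreal (f x))"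
    and "grid_closed N (density_support N f)"
    and "prob_space.indep_vars M (\<lambda>_. borel) X {1..N}"
    and "y \<in> borel_measurable (Leb {1..N})"
    and "integrable M (\<lambda>\<omega>. (y (subvector X {1..N} \<omega>))\<^sup>2)"
    and "generalized_ADD M X N f y yG"
    and "classical_ADD M X N f y yC"
  shows "\<forall>u\<subseteq>{1..N}. AE x in marginal_measure N f u. yG u x = yC u x"
proof (intro allI impI)
  fix u assume u: "u \<subseteq> {1..N}"
  interpret independent_density M X N f
    by (intro independent_density.intro independent_density_axioms.intro assms(1-4,6))
  have G: "\<And>u. u \<subseteq> {1..N} \<Longrightarrow> u \<noteq> {} \<Longrightarrow> yG u \<in> borel_measurable (Leb u)"
      "weak_annihilating N f yG" "is_decomposition M X N y yG"
    using assms(9) by (auto simp: generalized_ADD_def)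
  have C: "\<And>u. u \<subseteq> {1..N} \<Longrightarrow> u \<noteq> {} \<Longrightarrow> yC u \<in> borel_measurable (Leb u)"
      "strong_annihilating N f yC" "is_decomposition M X N y yC"
    using assms(10) by (auto simp: classical_ADD_def)
  \<comment> \<open>After this both families are decompositions of \<open>y\<close> under the same
    strong condition, so uniqueness identifies them.\<close>
  have "strong_annihilating N f yG"
    by (rule weak_imp_strong_annihilating[OF _ G(2)]) (rule G(1))
  with G(1) show "AE x in marginal_measure N f u. yG u x = yC u x"
    using G(3) C u by (rule strong_decomposition_unique)
qed

end
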